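(* Let $g>0$, $H>0$, $U\in\mathbb R$, $P\ge1$, $\Delta x>0$, and let $\alpha_h\ge0$, $\alpha_u\ge0$ be real. Let $\mathbf h(t),\mathbf u(t)\in\mathbb R^{2P+2}$, $t\ge0$, be continuously differentiable solutions of the semi-discrete two-element scheme $$\frac{d\mathbf h}{dt}+\mathbf D(H\mathbf u+U\mathbf h)=\tau_{11}H\mathbf K\mathbf u+\tau_{12}U\mathbf K\mathbf h-\alpha_h\mathbf M^{-1}\widetilde{\mathbf B}^\top\widetilde{\mathbf B}\mathbf h,$$ $$\begin{aligned}\frac{d\mathbf u}{dt}&+\mathbf D\left(g\mathbf h+U\mathbf u-\frac{H^2U}{3}\mathbf D^2\mathbf u-\frac{H^2}{3}\mathbf D\frac{d\mathbf u}{dt}\right)=\tau_{21}g\mathbf K\mathbf h+\tau_{22}U\mathbf K\mathbf u\\&+H^2\left(\gamma_{21}\mathbf D\mathbf K+\gamma_{22}\mathbf K\mathbf D+\gamma_{23}\mathbf K^2\right)\frac{d\mathbf u}{dt}\\&+H^2U\left(\sigma_{21}\mathbf D^2\mathbf K+\sigma_{22}\mathbf D\mathbf K\mathbf D+\sigma_{23}\mathbf D\mathbf K^2+\sigma_{24}\mathbf K\mathbf D^2+\sigma_{25}\mathbf K\mathbf D\mathbf K+\sigma_{26}\mathbf K^2\mathbf D+\sigma_{27}\mathbf K^3\right)\mathbf u-\alpha_u\mathbf M^{-1}\widetilde{\mathbf B}^\top\widetilde{\mathbf B}\mathbf u,\end{aligned}$$ where $\mathbf K=\mathbf M^{-1}\widetilde{\mathbf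 B}$ and $\tau_{11}=\tau_{12}=\tau_{21}=\tau_{22}=\frac12$, $\gamma_{21}=\gamma_{22}=\sigma_{21}=\sigma_{22}=\sigma_{24}=-\frac16$, $\gamma_{23}=\sigma_{23}=\sigma_{25}=\sigma_{26}=\frac1{12}$, $\sigma_{27}=-\frac1{24}$. Considering only boundary contributions from the interface (see context), the scheme is conservative: for all $t\ge 0$, $$g\left\langle\mathbf 1,\frac{d\mathbf h}{dt}\right\rangle_{\mathbf M}=0,\qquad H\left\langle\mathbf 1,\frac{d\mathbf u}{dt}\right\rangle_{\mathbf M}=0,$$ where $\mathbf 1=(1,\dots,1)^\top\in\mathbb R^{2P+2}$.
   Context: Operators: let $-1=\xi_1<\dots<\xi_{P+1}=1$ be the Gauss–Lobatto quadrature nodes on $[-1,1]$ with weights $\omega_i>0$ (exact for polynomials of degree $\le2P-1$), $\ell_j$ the Lagrange polynomials at these nodes, $M=\operatorname{diag}(\omega_1,\dots,\omega_{P+1})$, $Q_{ij}=\int_{-1}^1\ell_i\ell_j'\,d\xi=\sum_k\omega_k\ell_i(\xi_k)\ell_j'(\xi_k)$, $D=M^{-1}Q$, $D_x=\frac2{\Delta x}D$, $M_x=\frac{\Delta x}2M$. Then $M_xD_x+D_x^\top M_x=\operatorname{diag}(-1,0,\dots,0,1)$. Two-element model: the elements $\Omega^-$ (left) and $\Omega^+$ (right) share an interface, each of length $\Delta x$; grid vectors in $\mathbb R^{2P+2}$ are stacked as $\mathbf v=[\mathbf v^-;\mathbf v^+]$ with $\mathbf v^\pm\in\mathbb R^{P+1}$.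 Let $\mathbf D=\operatorname{diag}(D_x,D_x)$, $\mathbf M=\operatorname{diag}(M_x,M_x)$ (block diagonal), $\mathbf e_L=(1,0,\dots,0)^\top$, $\mathbf e_R=(0,\dots,0,1)^\top\in\mathbb R^{P+1}$, $$\widetilde{\mathbf B}=\begin{bmatrix}\mathbf e_R\mathbf e_R^\top&-\mathbf e_R\mathbf e_L^\top\\\mathbf e_L\mathbf e_R^\top&-\mathbf e_L\mathbf e_L^\top\end{bmatrix},\qquad\widetilde{\mathbf D}=\mathbf D-\frac12\mathbf M^{-1}\widetilde{\mathbf B},\qquad\langle\mathbf u,\mathbf v\rangle_{\mathbf M}=\mathbf v^\top\mathbf M\mathbf u.$$ "Considering only boundary contributions from the interface" means that the outer boundary contributions of the fluxes are absent: with $\mathbf f=H\mathbf u+U\mathbf h$ and $\mathbf q=g\mathbf h+U\mathbf u-\frac{H^2U}{3}\widetilde{\mathbf D}^2\mathbf u-\frac{H^2}{3}\widetilde{\mathbf D}\frac{d\mathbf u}{dt}$, it is assumed that $f^+_{P+1}-f^-_1=0$ and $q^+_{P+1}-q^-_1=0$ for all $t\ge 0$. *)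

theory Defs
  imports "HOL-Computational_Algebra.Polynomial"
    "HOL-Analysis.Henstock_Kurzweil_Integration"
    "Jordan_Normal_Form.Gauss_Jordan_Elimination"
begin

(* Indices start at 0: the node xi_i of the mathematical text is \<xi> (i - 1) here. *)

(* The (P+1)-point Gauss-Lobatto rule is the unique rule whose nodes include both endpoints
   and which is exact for all polynomials of degree at most 2P - 1. *)
definition gauss_lobatto :: "nat \<Rightarrow> (nat \<Rightarrow> real) \<Rightarrow> (nat \<Rightarrow> real) \<Rightarrow> bool" where
  "gauss_lobatto P \<xi> \<omega> \<longleftrightarrow>
     \<xi> 0 = - 1 \<and> \<xi> P = 1 \<and> strict_mono_on {..P} \<xi> \<and> (\<forall>i\<le>P. \<omega> i > 0) \<and>
     (\<forall>p :: real poly. degree p \<le> 2 * P - 1 \<longrightarrow>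
        (\<Sum>i\<le>P. \<omega> i * poly p (\<xi> i)) = integral {-1..1} (poly p))"

definition lagrange_poly :: "nat \<Rightarrow> (nat \<Rightarrow> real) \<Rightarrow> nat \<Rightarrow> real poly" where
  "lagrange_poly P \<xi> j = (\<Prod>k\<in>{..P} - {j}. Polynomial.smult (1 / (\<xi> j - \<xi> k)) [:- \<xi> k, 1:])"

(* Only meaningful for invertible matrices. *)
definition minv :: "real mat \<Rightarrow> real mat" where
  "minv A = the (mat_inverse A)"

definition outer :: "real vec \<Rightarrow> real vec \<Rightarrow> real mat" where
  "outer a b = mat (dim_vec a) (dim_vec b) (\<lambda>(i, j). a $ i * b $ j)"

definition block_diag2 :: "real mat \<Rightarrow> real mat" where
  "block_diag2 A = four_block_mat A (0\<^sub>m (dim_row A) (dim_col A)) (0\<^sub>m (dim_row A) (dim_col A)) A"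

definition M_ref :: "nat \<Rightarrow> (nat \<Rightarrow> real) \<Rightarrow> real mat" where
  "M_ref P \<omega> = mat_diag (P + 1) \<omega>"

definition Q_ref :: "nat \<Rightarrow> (nat \<Rightarrow> real) \<Rightarrow> real mat" where
  "Q_ref P \<xi> = mat (P + 1) (P + 1)
     (\<lambda>(i, j). integral {-1..1}
        (\<lambda>x. poly (lagrange_poly P \<xi> i) x * poly (pderiv (lagrange_poly P \<xi> j)) x))"

definition D_ref :: "nat \<Rightarrow> (nat \<Rightarrow> real) \<Rightarrow> (nat \<Rightarrow> real) \<Rightarrow> real mat" where
  "D_ref P \<xi> \<omega> = minv (M_ref P \<omega>) * Q_ref P \<xi>"

definition D_x :: "nat \<Rightarrow> (nat \<Rightarrow> real) \<Rightarrow> (nat \<Rightarrow> real) \<Rightarrow> real \<Rightarrow> real mat" where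
  "D_x P \<xi> \<omega> dx = (2 / dx) \<cdot>\<^sub>m D_ref P \<xi> \<omega>"

definition M_x :: "nat \<Rightarrow> (nat \<Rightarrow> real) \<Rightarrow> real \<Rightarrow> real mat" where
  "M_x P \<omega> dx = (dx / 2) \<cdot>\<^sub>m M_ref P \<omega>"

definition e_L :: "nat \<Rightarrow> real vec" where
  "e_L P = unit_vec (P + 1) 0"

definition e_R :: "nat \<Rightarrow> real vec" where
  "e_R P = unit_vec (P + 1) P"

definition B_tilde :: "nat \<Rightarrow> real mat" where
  "B_tilde P = four_block_mat
     (outer (e_R P) (e_R P)) (- outer (e_R P) (e_L P))
     (outer (e_L P) (e_R P)) (- outer (e_L P) (e_L P))"

definition inner_M :: "real mat \<Rightarrow> real vec \<Rightarrow> real vec \<Rightarrow> real" where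
  "inner_M M u v = scalar_prod v (M *\<^sub>v u)"

definition ones :: "nat \<Rightarrow> real vec" where
  "ones n = vec n (\<lambda>_. 1)"

(* v is continuously differentiable from [0, \<infinity>) to R^n with derivative v'; the derivative
   is taken componentwise, and is one-sided at 0. *)
definition C1_curve :: "nat \<Rightarrow> (real \<Rightarrow> real vec) \<Rightarrow> (real \<Rightarrow> real vec) \<Rightarrow> bool" where
  "C1_curve n v v' \<longleftrightarrow>
     (\<forall>t\<ge>0. v t \<in> carrier_vec n \<and> v' t \<in> carrier_vec n) \<and>
     (\<forall>i<n. (\<forall>t\<ge>0. ((\<lambda>s. v s $ i) has_real_derivative v' t $ i) (at t within {0..})) \<and>
             continuous_on {0..} (\<lambda>t. v' t $ i))"

end

(* Writing Dt = D - K / 2, the coefficients of the scheme are those of the expanded powers of Dt,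
   so it reads h' + Dt f = - alpha_h M^{-1} B^T B h and u' + Dt q = - alpha_u M^{-1} B^T B u.
   By the fundamental theorem of calculus and the exactness of the quadrature, 1^T M D v is the sum
   of the boundary terms of both elements; the correction 1^T B / 2 cancels exactly the interface
   values, so 1^T M Dt v is the difference of the two outer boundary values. The dissipation drops
   out because B 1 = 0. *)

theory Submission
  imports Defs
begin

section \<open>Matrices\<close>

lemma ones_carrier [simp]: "ones n \<in> carrier_vec n"
  by (simp add: ones_def)

text \<open>Swapping the two sums collects everything that multiplies one entry of \<open>v\<close>.
  Conservation thereby becomes a question about the column sums of a matrix.\<close>

lemma scalar_prod_ones_mult_mat_vec:
  assumes "A \<in> carrier_mat n m" and "v \<in> carrier_vec m"
  shows "scalar_prod (ones n) (A *\<^sub>v v) = (\<Sum>j<m. (\<Sum>i<n. A $$ (i, j)) * v $ j)"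
proof -
  have "scalar_prod (ones n) (A *\<^sub>v v) = (\<Sum>i<n. \<Sum>j<m. A $$ (i, j) * v $ j)"
    using assms
    by (auto simp: scalar_prod_def ones_def atLeast0LessThan intro!: sum.cong)
  also have "\<dots> = (\<Sum>j<m. (\<Sum>i<n. A $$ (i, j)) * v $ j)"
    by (subst sum.swap) (simp add: sum_distrib_right)
  finally show ?thesis .
qed

lemma smult_mat_mult_vec:
  fixes a :: "'a::comm_semiring_1"
  assumes "A \<in> carrier_mat n m" and "v \<in> carrier_vec m"
  shows "(a \<cdot>\<^sub>m A) *\<^sub>v v = a \<cdot>\<^sub>v (A *\<^sub>v v)"
  using assms by (intro eq_vecI) auto

text \<open>An explicit two-sided inverse makes \<open>A\<close> a unit of the matrix ring, which
  rules out the \<open>None\<close> result of \<open>mat_inverse\<close>; hence \<open>the\<close>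
  in \<open>minv\<close> returns a genuine inverse.\<close>

lemma minv_inverse:
  assumes A: "A \<in> carrier_mat n n" and B: "B \<in> carrier_mat n n"
    and AB: "A * B = 1\<^sub>m n" and BA: "B * A = 1\<^sub>m n"
  shows "minv A \<in> carrier_mat n n" and "A * minv A = 1\<^sub>m n"
proof -
  have "A \<in> Units (ring_mat TYPE(real) n ())"
    using A B AB BA by (auto simp: Units_def ring_mat_def)
  then obtain C where "mat_inverse A = Some C"
    using mat_inverse(1)[OF A, where b = "()"] by (cases "mat_inverse A") auto
  then show "minv A \<in> carrier_mat n n" and "A * minv A = 1\<^sub>m n"
    using mat_inverse(2)[OF A] by (auto simp: minv_def)
qed

lemma mat_diag_eq_one:
  assumes "\<And>i. i < n \<Longrightarrow> f i = 1"
  shows "mat_diag n f = 1\<^sub>m n"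
  using assms by (intro eq_matI) (auto simp: mat_diag_def)

lemma block_diag2_carrier [simp]:
  "A \<in> carrier_mat n n \<Longrightarrow> block_diag2 A \<in> carrier_mat (n + n) (n + n)"
  by (auto simp: block_diag2_def)

lemma block_diag2_mult:
  assumes "A \<in> carrier_mat n n" and "B \<in> carrier_mat n n"
  shows "block_diag2 A * block_diag2 B = block_diag2 (A * B)"
  using assms unfolding block_diag2_def
  by (subst mult_four_block_mat[of _ n n _ n _ n _ _ n _ n]) auto

lemma block_diag2_one: "block_diag2 (1\<^sub>m n) = 1\<^sub>m (n + n)"
  by (rule eq_matI) (auto simp: block_diag2_def)

lemma transpose_block_diag2:
  assumes "A \<in> carrier_mat n n"
  shows "transpose_mat (block_diag2 A) = block_diag2 (transpose_mat A)"
  using assms by (intro eq_matI) (auto simp: block_diag2_def)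

lemma sum_lessThan_add:
  fixes f :: "nat \<Rightarrow> 'a::comm_monoid_add"
  shows "(\<Sum>i<m + n. f i) = (\<Sum>i<m. f i) + (\<Sum>i<n. f (m + i))"
  by (induction n) (auto simp: add.assoc)

text \<open>Columns \<open>j\<close> and \<open>n + j\<close> both have the column sum of column
  \<open>j\<close> of \<open>A\<close>, so corresponding entries of the two elements share one
  factor.\<close>

lemma scalar_prod_ones_block_diag2:
  assumes A: "A \<in> carrier_mat n n" and v: "v \<in> carrier_vec (n + n)"
  shows "scalar_prod (ones (n + n)) (block_diag2 A *\<^sub>v v)
    = (\<Sum>j<n. (\<Sum>i<n. A $$ (i, j)) * (v $ j + v $ (n + j)))"
proof -
  have "scalar_prod (ones (n + n)) (block_diag2 A *\<^sub>v v)
    = (\<Sum>j<n + n. (\<Sum>i<n + n. block_diag2 A $$ (i, j)) * v $ j)"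
    using A v by (intro scalar_prod_ones_mult_mat_vec) auto
  also have "\<dots> = (\<Sum>j<n. (\<Sum>i<n. A $$ (i, j)) * v $ j) + (\<Sum>j<n. (\<Sum>i<n. A $$ (i, j)) * v $ (n + j))"
    using A unfolding sum_lessThan_add
    by (intro arg_cong2[where f = "(+)"] sum.cong arg_cong2[where f = "(*)"])
      (auto simp: block_diag2_def)
  finally show ?thesis by (simp add: sum.distrib distrib_left)
qed

text \<open>In \<open>inner_M\<close> the matrix acts on the first argument, here the ones. Symmetry
  moves it onto \<open>v\<close>, where it can meet the \<open>minv M\<close> of the scheme.\<close>

lemma inner_M_ones:
  assumes M: "M \<in> carrier_mat n n" and sym: "transpose_mat M = M" and v: "v \<in> carrier_vec n"
  shows "inner_M M (ones n) v = scalar_prod (ones n) (M *\<^sub>v v)"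
  using transpose_vec_mult_scalar[OF M v ones_carrier] M v
  by (simp add: inner_M_def sym comm_scalar_prod[of v n])

section \<open>Gauss--Lobatto operators\<close>

lemma gauss_lobatto_inj:
  assumes "gauss_lobatto P \<xi> \<omega>" and "i \<le> P" and "j \<le> P" and "\<xi> i = \<xi> j"
  shows "i = j"
proof -
  have "inj_on \<xi> {..P}"
    using assms(1) by (auto simp: gauss_lobatto_def intro: strict_mono_on_imp_inj_on)
  then show ?thesis using assms by (auto dest: inj_onD)
qed

lemma poly_lagrange_poly_node:
  assumes GL: "gauss_lobatto P \<xi> \<omega>" and i: "i \<le> P" and j: "j \<le> P"
  shows "poly (lagrange_poly P \<xi> j) (\<xi> i) = of_bool (i = j)"
proof (cases "i = j")
  case True
  have "\<xi> j - \<xi> k \<noteq> 0" if "k \<in> {..P} - {j}" for k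
    using gauss_lobatto_inj[OF GL j, of k] that by auto
  then show ?thesis
    using True by (auto simp: lagrange_poly_def poly_prod divide_simps intro!: prod.neutral)
next
  case False
  then show ?thesis using i by (auto simp: lagrange_poly_def poly_prod intro!: prod_zero bexI[of _ i])
qed

lemma degree_lagrange_poly:
  assumes "j \<le> P"
  shows "degree (lagrange_poly P \<xi> j) \<le> P"
proof -
  have "degree (lagrange_poly P \<xi> j)
    \<le> sum (degree \<circ> (\<lambda>k. Polynomial.smult (1 / (\<xi> j - \<xi> k)) [:- \<xi> k, 1:])) ({..P} - {j})"
    unfolding lagrange_poly_def by (rule degree_prod_sum_le) simp
  also have "\<dots> \<le> (\<Sum>k\<in>{..P} - {j}. 1)"
    by (intro sum_mono) (simp add: degree_smult_eq)
  also have "\<dots> = P" using assms by simp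
  finally show ?thesis .
qed

text \<open>Exactness of the quadrature is used in both directions. It first collapses the entry to
  one term, since the Lagrange polynomial of index \<open>i\<close> vanishes at all other nodes; the
  column sum is then the quadrature of the derivative of the Lagrange polynomial of index
  \<open>j\<close>, hence its integral and a difference of endpoint values.\<close>

lemma Q_ref_col_sum:
  assumes GL: "gauss_lobatto P \<xi> \<omega>" and P: "P \<ge> 1" and j: "j \<le> P"
  shows "(\<Sum>i<P + 1. Q_ref P \<xi> $$ (i, j)) = of_bool (j = P) - of_bool (j = 0)"
proof -
  let ?l = "lagrange_poly P \<xi>"
  note GLd = GL[unfolded gauss_lobatto_def]
  have exact: "(\<Sum>i\<le>P. \<omega> i * poly p (\<xi> i)) = integral {-1..1} (poly p)"
    if "degree p \<le> 2 * P - 1" for p :: "real poly"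
    using GLd that by blast
  have deg': "degree (pderiv (?l j)) \<le> P - 1"
    using degree_lagrange_poly[OF j, of \<xi>] by (simp add: degree_pderiv)
  have entry: "Q_ref P \<xi> $$ (i, j) = \<omega> i * poly (pderiv (?l j)) (\<xi> i)" if i: "i \<le> P" for i
  proof -
    have "Q_ref P \<xi> $$ (i, j) = integral {-1..1} (poly (?l i * pderiv (?l j)))"
      using i j by (auto simp: Q_ref_def intro!: arg_cong[where f = "integral _"])
    also have "\<dots> = (\<Sum>k\<le>P. \<omega> k * poly (?l i * pderiv (?l j)) (\<xi> k))"
    proof (rule exact[symmetric])
      \<comment> \<open>The degrees P and P - 1 add up to 2P - 1, exactly the limit of exactness;
        \<open>P \<ge> 1\<close> keeps the truncated subtraction honest.\<close>
      show "degree (?l i * pderiv (?l j)) \<le> 2 * P - 1"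
        using degree_mult_le[of "?l i" "pderiv (?l j)"] degree_lagrange_poly[OF i, of \<xi>] deg' P
        by linarith
    qed
    also have "\<dots> = (\<Sum>k\<le>P. if k = i then \<omega> i * poly (pderiv (?l j)) (\<xi> i) else 0)"
      using poly_lagrange_poly_node[OF GL _ i] by (intro sum.cong) auto
    also have "\<dots> = \<omega> i * poly (pderiv (?l j)) (\<xi> i)"
      using i by simp
    finally show ?thesis .
  qed
  have "(\<Sum>i<P + 1. Q_ref P \<xi> $$ (i, j)) = (\<Sum>i\<le>P. \<omega> i * poly (pderiv (?l j)) (\<xi> i))"
    by (auto simp: entry lessThan_Suc_atMost intro!: sum.cong)
  also have "\<dots> = integral {-1..1} (poly (pderiv (?l j)))"
    using deg' by (intro exact) linarith
  also have "\<dots> = poly (?l j) 1 - poly (?l j) (-1)"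
    by (intro integral_unique fundamental_theorem_of_calculus)
      (auto simp: has_real_derivative_iff_has_vector_derivative[symmetric]
        intro!: DERIV_subset[OF poly_DERIV])
  \<comment> \<open>The endpoints 1 and -1 are the nodes of index \<open>P\<close> and 0, so the
    Lagrange values there are Kronecker deltas.\<close>
  also have "\<dots> = of_bool (j = P) - of_bool (j = 0)"
    using poly_lagrange_poly_node[OF GL order_refl j] poly_lagrange_poly_node[OF GL le0 j] GLd
    by auto
  finally show ?thesis .
qed

text \<open>The scalings dx/2 and 2/dx cancel, so the product is independent of the element length.
  The positive weights make the diagonal reference mass matrix invertible, with the reciprocal
  weights as inverse.\<close>

lemma M_x_mult_D_x:
  assumes GL: "gauss_lobatto P \<xi> \<omega>" and dx: "dx > 0"
  shows "M_x P \<omega> dx * D_x P \<xi> \<omega> dx = Q_ref P \<xi>"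
    and "D_x P \<xi> \<omega> dx \<in> carrier_mat (P + 1) (P + 1)"
proof -
  let ?n = "P + 1"
  have M: "M_ref P \<omega> \<in> carrier_mat ?n ?n" and Q: "Q_ref P \<xi> \<in> carrier_mat ?n ?n"
    by (simp_all add: M_ref_def Q_ref_def)
  have pos: "\<omega> i > 0" if "i < ?n" for i
    using GL that by (auto simp: gauss_lobatto_def)
  have N: "mat_diag ?n (\<lambda>i. 1 / \<omega> i) \<in> carrier_mat ?n ?n" by simp
  have inv: "M_ref P \<omega> * mat_diag ?n (\<lambda>i. 1 / \<omega> i) = 1\<^sub>m ?n"
    "mat_diag ?n (\<lambda>i. 1 / \<omega> i) * M_ref P \<omega> = 1\<^sub>m ?n"
    using pos unfolding M_ref_def mat_diag_diag by (force intro!: mat_diag_eq_one)+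
  note mi = minv_inverse[OF M N inv]
  show "D_x P \<xi> \<omega> dx \<in> carrier_mat ?n ?n"
    using mi Q by (simp add: D_x_def D_ref_def)
  have DQ: "minv (M_ref P \<omega>) * Q_ref P \<xi> \<in> carrier_mat ?n ?n"
    using mi(1) Q by (rule mult_carrier_mat)
  have "M_x P \<omega> dx * D_x P \<xi> \<omega> dx = M_ref P \<omega> * (minv (M_ref P \<omega>) * Q_ref P \<xi>)"
    unfolding M_x_def D_x_def D_ref_def
    using mult_smult_assoc_mat[OF M smult_carrier_mat[OF DQ], of "dx / 2" "2 / dx"]
      mult_smult_distrib[OF M DQ, of "2 / dx"] dx
    by (auto intro!: eq_matI)
  also have "\<dots> = Q_ref P \<xi>"
    using assoc_mult_mat[OF M mi(1) Q] mi(2) Q by simp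
  finally show "M_x P \<omega> dx * D_x P \<xi> \<omega> dx = Q_ref P \<xi>" .
qed

text \<open>Each block is diagonal with entries dx/2 times a positive weight. This gives symmetry,
  and the reciprocal entries in \<open>N\<close> supply the witness for
  \<open>minv_inverse\<close>.\<close>

lemma block_diag2_M_x:
  assumes GL: "gauss_lobatto P \<xi> \<omega>" and dx: "dx > 0"
  defines "M \<equiv> block_diag2 (M_x P \<omega> dx)" and "n \<equiv> 2 * P + 2"
  shows "M \<in> carrier_mat n n" and "transpose_mat M = M"
    and "minv M \<in> carrier_mat n n" and "M * minv M = 1\<^sub>m n"
proof -
  let ?n = "P + 1"
  define N where "N = mat_diag ?n (\<lambda>i. 2 / (dx * \<omega> i))"
  \<comment> \<open>The size is written as a sum of two equal block sizes, the shape in which the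
    lemmas on \<open>block_diag2\<close> are stated.\<close>
  have n: "n = ?n + ?n" by (simp add: n_def)
  have M_x: "M_x P \<omega> dx = mat_diag ?n (\<lambda>i. dx / 2 * \<omega> i)"
    by (rule eq_matI) (auto simp: M_x_def M_ref_def mat_diag_def)
  have pos: "\<omega> i > 0" if "i < ?n" for i
    using GL that by (auto simp: gauss_lobatto_def)
  have c: "M_x P \<omega> dx \<in> carrier_mat ?n ?n" "N \<in> carrier_mat ?n ?n"
    by (simp_all add: M_x N_def)
  show M: "M \<in> carrier_mat n n"
    using c by (simp add: M_def n del: add_Suc_right add_Suc)
  have "transpose_mat (M_x P \<omega> dx) = M_x P \<omega> dx"
    by (rule eq_matI) (auto simp: M_x mat_diag_def)
  then show "transpose_mat M = M"
    using transpose_block_diag2[OF c(1)] by (simp add: M_def)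
  have "M_x P \<omega> dx * N = 1\<^sub>m ?n" "N * M_x P \<omega> dx = 1\<^sub>m ?n"
    using dx pos unfolding M_x N_def mat_diag_diag by (force intro!: mat_diag_eq_one)+
  then have "M * block_diag2 N = 1\<^sub>m n" "block_diag2 N * M = 1\<^sub>m n"
    unfolding M_def n block_diag2_mult[OF c] block_diag2_mult[OF c(2,1)]
    by (simp_all only: block_diag2_one)
  moreover have "block_diag2 N \<in> carrier_mat n n" unfolding n by (rule block_diag2_carrier[OF c(2)])
  ultimately show "minv M \<in> carrier_mat n n" and "M * minv M = 1\<^sub>m n"
    using minv_inverse[OF M] by blast+
qed

text \<open>Blockwise the product of mass and derivative matrix is \<open>Q_ref\<close>, whose
  column sums pick the last minus the first value on each element. Entries 0 to P belong to the left
  element, P + 1 to 2P + 1 to the right one.\<close>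

lemma scalar_prod_ones_MD:
  assumes GL: "gauss_lobatto P \<xi> \<omega>" and dx: "dx > 0" and P: "P \<ge> 1"
    and v: "v \<in> carrier_vec (2 * P + 2)"
  shows "scalar_prod (ones (2 * P + 2))
      (block_diag2 (M_x P \<omega> dx) *\<^sub>v (block_diag2 (D_x P \<xi> \<omega> dx) *\<^sub>v v))
    = v $ P - v $ 0 + (v $ (2 * P + 1) - v $ (P + 1))"
proof -
  let ?n = "P + 1"
  note D = M_x_mult_D_x[OF GL dx]
  have M: "M_x P \<omega> dx \<in> carrier_mat ?n ?n" and Q: "Q_ref P \<xi> \<in> carrier_mat ?n ?n"
    by (simp_all add: M_x_def M_ref_def Q_ref_def)
  have n: "2 * P + 2 = ?n + ?n" by simp
  note v' = v[unfolded n]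
  have "scalar_prod (ones (?n + ?n))
      (block_diag2 (M_x P \<omega> dx) *\<^sub>v (block_diag2 (D_x P \<xi> \<omega> dx) *\<^sub>v v))
    = scalar_prod (ones (?n + ?n)) (block_diag2 (Q_ref P \<xi>) *\<^sub>v v)"
    unfolding D(1)[symmetric] block_diag2_mult[OF M D(2), symmetric]
    by (subst assoc_mult_mat_vec[OF block_diag2_carrier[OF M] block_diag2_carrier[OF D(2)] v']) simp
  also have "\<dots> = (\<Sum>j<?n. (\<Sum>i<?n. Q_ref P \<xi> $$ (i, j)) * (v $ j + v $ (?n + j)))"
    by (rule scalar_prod_ones_block_diag2[OF Q v'])
  also have "\<dots> = (\<Sum>j<?n. (of_bool (j = P) - of_bool (j = 0)) * (v $ j + v $ (?n + j)))"
    using Q_ref_col_sum[OF GL P] by (intro sum.cong refl) (simp only: lessThan_iff)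
  also have "\<dots> = (\<Sum>j<?n. of_bool (j = P) * (v $ j + v $ (?n + j)))
      - (\<Sum>j<?n. of_bool (j = 0) * (v $ j + v $ (?n + j)))"
    by (simp add: left_diff_distrib sum_subtractf)
  also have "\<dots> = (v $ P + v $ (?n + P)) - (v $ 0 + v $ ?n)"
    by (simp add: of_bool_def if_distrib[of "\<lambda>x. x * _"] cong: if_cong)
  also have "?n + P = 2 * P + 1" by simp
  finally show ?thesis unfolding n by simp
qed

section \<open>The interface matrix\<close>

lemma B_tilde_carrier [simp]: "B_tilde P \<in> carrier_mat (2 * P + 2) (2 * P + 2)"
  by (auto simp: B_tilde_def outer_def e_L_def e_R_def)

text \<open>The four blocks form a single rank-one matrix: the column (e_R; e_L) times the row (e_R;
  -e_L). The row takes the jump across the interface, between the entries \<open>P\<close> and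
  \<open>P + 1\<close>, and the column writes it to both of them.\<close>

lemma B_tilde_index:
  assumes "i < 2 * P + 2" and "j < 2 * P + 2"
  shows "B_tilde P $$ (i, j)
    = (of_bool (i = P) + of_bool (i = P + 1)) * (of_bool (j = P) - of_bool (j = P + 1))"
  using assms by (auto simp: B_tilde_def outer_def e_L_def e_R_def)

text \<open>The jump is written twice, once on each side of the interface. The resulting factor 2 is
  what the 1/2 in the corrected derivative compensates.\<close>

lemma scalar_prod_ones_B_tilde:
  assumes "v \<in> carrier_vec (2 * P + 2)"
  shows "scalar_prod (ones (2 * P + 2)) (B_tilde P *\<^sub>v v) = 2 * v $ P - 2 * v $ (P + 1)"
proof -
  let ?n = "2 * P + 2"
  have "scalar_prod (ones ?n) (B_tilde P *\<^sub>v v) = (\<Sum>j<?n. (\<Sum>i<?n. B_tilde P $$ (i, j)) * v $ j)"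
    using assms by (intro scalar_prod_ones_mult_mat_vec B_tilde_carrier)
  also have "\<dots> = (\<Sum>j<?n. 2 * (of_bool (j = P) - of_bool (j = P + 1)) * v $ j)"
  proof (intro sum.cong refl)
    fix j assume "j \<in> {..<?n}"
    then have "(\<Sum>i<?n. B_tilde P $$ (i, j))
      = (\<Sum>i<?n. of_bool (i = P) + of_bool (i = P + 1)) * (of_bool (j = P) - of_bool (j = P + 1))"
      unfolding sum_distrib_right by (intro sum.cong refl) (simp only: B_tilde_index lessThan_iff)
    \<comment> \<open>Both interface indices lie below 2P + 2, so each indicator contributes
      once.\<close>
    also have "(\<Sum>i<?n. of_bool (i = P) + of_bool (i = P + 1)) = (2 :: real)"
      by (simp add: sum.distrib of_bool_def del: sum_of_bool_eq)
    finally show "(\<Sum>i<?n. B_tilde P $$ (i, j)) * v $ j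
      = 2 * (of_bool (j = P) - of_bool (j = P + 1)) * v $ j" by simp
  qed
  also have "\<dots> = 2 * (\<Sum>j<?n. of_bool (j = P) * v $ j) - 2 * (\<Sum>j<?n. of_bool (j = P + 1) * v $ j)"
    by (simp add: algebra_simps sum_subtractf sum_distrib_left del: sum_of_bool_mult_eq sum_mult_of_bool_eq)
  also have "\<dots> = 2 * v $ P - 2 * v $ (P + 1)"
    by (simp add: of_bool_def if_distrib[of "\<lambda>x. x * _"] cong: if_cong)
  finally show ?thesis .
qed

text \<open>The column sums of the transpose are the row sums of \<open>B_tilde\<close>, and these
  vanish because a constant has no jump. This makes the dissipation conservative.\<close>

lemma scalar_prod_ones_B_tilde_transpose:
  assumes w: "w \<in> carrier_vec (2 * P + 2)"
  shows "scalar_prod (ones (2 * P + 2)) (transpose_mat (B_tilde P) *\<^sub>v w) = 0"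
proof -
  let ?n = "2 * P + 2"
  have "(\<Sum>i<?n. transpose_mat (B_tilde P) $$ (i, j)) = 0" if j: "j < ?n" for j
  proof -
    have "(\<Sum>i<?n. transpose_mat (B_tilde P) $$ (i, j)) = (\<Sum>i<?n. B_tilde P $$ (j, i))"
      using j carrier_matD[OF B_tilde_carrier[of P]] by (intro sum.cong) auto
    also have "\<dots> = (of_bool (j = P) + of_bool (j = P + 1))
        * (\<Sum>i<?n. of_bool (i = P) - of_bool (i = P + 1))"
      using j by (simp add: B_tilde_index sum_distrib_left)
    also have "(\<Sum>i<?n. of_bool (i = P) - of_bool (i = P + 1)) = (0 :: real)"
      by (simp add: sum_subtractf of_bool_def del: sum_of_bool_eq)
    finally show ?thesis by simp
  qed
  then show ?thesis
    by (subst scalar_prod_ones_mult_mat_vec[OF transpose_carrier_mat[THEN iffD2, OF B_tilde_carrier] w])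
      (simp del: sum.lessThan_Suc)
qed

section \<open>Conservation\<close>

text \<open>The penalty coefficients are those of (Dt^2 - D^2)/3 and (Dt^3 - D^3)/3, expanded for
  non-commuting \<open>D\<close> and \<open>K\<close>. Every factor \<open>K\<close> carries -1/2,
  so words with one, two or three factors \<open>K\<close> receive -1/6, 1/12 or -1/24. The vector
  \<open>d\<close> stands for the dissipation.\<close>

lemma momentum_equation_factored:
  fixes D K :: "real mat"
  assumes D: "D \<in> carrier_mat n n" and K: "K \<in> carrier_mat n n"
    and v: "h \<in> carrier_vec n" "u \<in> carrier_vec n" "u' \<in> carrier_vec n"
    and d: "d \<in> carrier_vec n"
    and Dt: "Dt = D - (1/2) \<cdot>\<^sub>m K"
    and eq: "u' + D *\<^sub>v (g \<cdot>\<^sub>v h + U \<cdot>\<^sub>v u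
                   - (H\<^sup>2 * U / 3) \<cdot>\<^sub>v ((D ^\<^sub>m 2) *\<^sub>v u)
                   - (H\<^sup>2 / 3) \<cdot>\<^sub>v (D *\<^sub>v u'))
        = (1/2 * g) \<cdot>\<^sub>v (K *\<^sub>v h) + (1/2 * U) \<cdot>\<^sub>v (K *\<^sub>v u)
          + H\<^sup>2 \<cdot>\<^sub>v (((-1/6) \<cdot>\<^sub>m (D * K) + (-1/6) \<cdot>\<^sub>m (K * D) + (1/12) \<cdot>\<^sub>m (K ^\<^sub>m 2)) *\<^sub>v u')
          + (H\<^sup>2 * U) \<cdot>\<^sub>v (((-1/6) \<cdot>\<^sub>m (D ^\<^sub>m 2 * K) + (-1/6) \<cdot>\<^sub>m (D * K * D)
                        + (1/12) \<cdot>\<^sub>m (D * K ^\<^sub>m 2) + (-1/6) \<cdot>\<^sub>m (K * D ^\<^sub>m 2)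
                        + (1/12) \<cdot>\<^sub>m (K * D * K) + (1/12) \<cdot>\<^sub>m (K ^\<^sub>m 2 * D)
                        + (-1/24) \<cdot>\<^sub>m (K ^\<^sub>m 3)) *\<^sub>v u)
          - d"
  shows "u' = - d - Dt *\<^sub>v (g \<cdot>\<^sub>v h + U \<cdot>\<^sub>v u
              - (H\<^sup>2 * U / 3) \<cdot>\<^sub>v ((Dt ^\<^sub>m 2) *\<^sub>v u) - (H\<^sup>2 / 3) \<cdot>\<^sub>v (Dt *\<^sub>v u'))"
proof -
  have dims: "dim_row D = n" "dim_row K = n" "dim_col D = n" "dim_col K = n"
    "dim_vec h = n" "dim_vec u = n" "dim_vec u' = n" "dim_vec d = n"
    using D K v d by auto
  have Dtc: "Dt \<in> carrier_mat n n"
    using D K by (auto simp: Dt)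
  have Dt_mult: "Dt *\<^sub>v w = D *\<^sub>v w - (1/2) \<cdot>\<^sub>v (K *\<^sub>v w)" if "w \<in> carrier_vec n" for w
    using D K that by (simp add: Dt minus_mult_distrib_mat_vec[of _ n n] smult_mat_mult_vec[of _ n n])
  \<comment> \<open>These rules turn sums, products and powers of matrices into nested applications
    of \<open>D\<close> and \<open>K\<close> to single vectors.\<close>
  note expand = Dt_mult numeral_2_eq_2 numeral_3_eq_3 smult_mat_mult_vec[of _ n n] mult_mat_vec[of _ n n]
    add_mult_distrib_mat_vec[of _ n n] mult_add_distrib_mat_vec[of _ n n]
    minus_mult_distrib_mat_vec[of _ n n] mult_minus_distrib_mat_vec[of _ n n]
    assoc_mult_mat_vec[of _ n n _ n]
  show ?thesis
  proof (rule eq_vecI)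
    fix i assume i: "i < dim_vec (- d - Dt *\<^sub>v (g \<cdot>\<^sub>v h + U \<cdot>\<^sub>v u
              - (H\<^sup>2 * U / 3) \<cdot>\<^sub>v ((Dt ^\<^sub>m 2) *\<^sub>v u) - (H\<^sup>2 / 3) \<cdot>\<^sub>v (Dt *\<^sub>v u')))"
    then have i: "i < n" using D K by (simp add: Dt)
    note i_eq = arg_cong[OF eq, of "\<lambda>w. w $ i"]
    show "u' $ i = (- d - Dt *\<^sub>v (g \<cdot>\<^sub>v h + U \<cdot>\<^sub>v u
              - (H\<^sup>2 * U / 3) \<cdot>\<^sub>v ((Dt ^\<^sub>m 2) *\<^sub>v u) - (H\<^sup>2 / 3) \<cdot>\<^sub>v (Dt *\<^sub>v u'))) $ i"
      \<comment> \<open>With \<open>index_mult_mat_vec\<close> removed, components of nested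
        products stay atoms instead of unfolding into scalar products of rows; the rest is
        arithmetic over these atoms.\<close>
      using i_eq i D K Dtc v d
      by (simp add: expand dims del: index_mult_mat_vec) argo
  qed (use D K v d in \<open>simp add: Dt\<close>)
qed

text \<open>The first-order case: the penalty is half of \<open>K\<close> applied to the flux
  itself, so it merges with \<open>D\<close>.\<close>

lemma mass_equation_factored:
  fixes D K :: "real mat"
  assumes D: "D \<in> carrier_mat n n" and K: "K \<in> carrier_mat n n"
    and v: "h \<in> carrier_vec n" "u \<in> carrier_vec n" "h' \<in> carrier_vec n"
    and d: "d \<in> carrier_vec n"
    and Dt: "Dt = D - (1/2) \<cdot>\<^sub>m K"
    and eq: "h' + D *\<^sub>v (H \<cdot>\<^sub>v u + U \<cdot>\<^sub>v h)
      = (1/2 * H) \<cdot>\<^sub>v (K *\<^sub>v u) + (1/2 * U) \<cdot>\<^sub>v (K *\<^sub>v h) - d"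
  shows "h' = - d - Dt *\<^sub>v (H \<cdot>\<^sub>v u + U \<cdot>\<^sub>v h)"
proof (rule eq_vecI)
  have dims: "dim_row D = n" "dim_row K = n" "dim_col D = n" "dim_col K = n"
    "dim_vec h = n" "dim_vec u = n" "dim_vec h' = n" "dim_vec d = n"
    using D K v d by auto
  fix i assume "i < dim_vec (- d - Dt *\<^sub>v (H \<cdot>\<^sub>v u + U \<cdot>\<^sub>v h))"
  then have i: "i < n" using D K by (simp add: Dt)
  show "h' $ i = (- d - Dt *\<^sub>v (H \<cdot>\<^sub>v u + U \<cdot>\<^sub>v h)) $ i"
    using arg_cong[OF eq, of "\<lambda>w. w $ i"] i D K v d
    by (simp add: Dt smult_mat_mult_vec[of _ n n] mult_mat_vec[of _ n n] mult_add_distrib_mat_vec[of _ n n]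
        minus_mult_distrib_mat_vec[of _ n n] dims del: index_mult_mat_vec)
qed (use D K v d in \<open>simp add: Dt\<close>)

text \<open>Both equations have this form, with (\<open>x\<close>, \<open>y\<close>) the pair (h, f)
  for mass and (u, q) for momentum, so one computation serves both.\<close>

lemma interface_flux_conservative:
  fixes M D Dt :: "real mat" and x y w :: "real vec"
  assumes GL: "gauss_lobatto P \<xi> \<omega>" and dx: "dx > 0" and P: "P \<ge> 1"
    and D: "D = block_diag2 (D_x P \<xi> \<omega> dx)"
    and M: "M = block_diag2 (M_x P \<omega> dx)"
    and B: "B = B_tilde P"
    and Dt: "Dt = D - (1/2) \<cdot>\<^sub>m (minv M * B)"
    and x: "x \<in> carrier_vec (2 * P + 2)" and y: "y \<in> carrier_vec (2 * P + 2)"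
    and w: "w = - (\<alpha> \<cdot>\<^sub>v ((minv M * transpose_mat B * B) *\<^sub>v x)) - Dt *\<^sub>v y"
    and outer: "y $ (2 * P + 1) - y $ 0 = 0"
  shows "inner_M M (ones (2 * P + 2)) w = 0"
proof -
  define n where "n = 2 * P + 2"
  note x = x[folded n_def] and y = y[folded n_def]
  note Mx = block_diag2_M_x[OF GL dx, folded M n_def]
  have Bc: "B \<in> carrier_mat n n" by (simp only: B n_def B_tilde_carrier)
  have "n = (P + 1) + (P + 1)" by (simp add: n_def)
  then have Dc: "D \<in> carrier_mat n n"
    unfolding D using block_diag2_carrier[OF M_x_mult_D_x(2)[OF GL dx]] by metis
  define z where "z = transpose_mat B *\<^sub>v (B *\<^sub>v x)"
  have c: "B *\<^sub>v x \<in> carrier_vec n" "B *\<^sub>v y \<in> carrier_vec n" "z \<in> carrier_vec n"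
    "D *\<^sub>v y \<in> carrier_vec n"
    using Bc Dc x y by (auto simp: z_def)
  \<comment> \<open>The mass matrix of the inner product removes the \<open>minv M\<close> in front
    of both the dissipation and the interface correction, leaving only products with
    \<open>B\<close> and its transpose.\<close>
  have cancel: "M *\<^sub>v (minv M *\<^sub>v v) = v" if "v \<in> carrier_vec n" for v
    using assoc_mult_mat_vec[OF Mx(1,3) that] Mx(4) that by simp
  have w_eq: "w = - (\<alpha> \<cdot>\<^sub>v (minv M *\<^sub>v z)) - (D *\<^sub>v y - (1/2) \<cdot>\<^sub>v (minv M *\<^sub>v (B *\<^sub>v y)))"
    using Mx(3) Bc Dc x y c unfolding w Dt z_def
    by (simp add: minus_mult_distrib_mat_vec[of _ n n] smult_mat_mult_vec[of _ n n] assoc_mult_mat_vec[of _ n n _ n]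
        assoc_mult_mat_vec[of "minv M * transpose_mat B" n n _ n])
  also have "\<dots> = (- \<alpha>) \<cdot>\<^sub>v (minv M *\<^sub>v z) - (D *\<^sub>v y - (1/2) \<cdot>\<^sub>v (minv M *\<^sub>v (B *\<^sub>v y)))"
    by (intro arg_cong2[where f = "(-)"] eq_vecI) auto
  finally have w_eq: "w = \<dots>" .
  have "w \<in> carrier_vec n" using Mx c by (simp add: w_eq)
  then have "inner_M M (ones n) w = scalar_prod (ones n) (M *\<^sub>v w)"
    by (rule inner_M_ones[OF Mx(1,2)])
  also have "M *\<^sub>v w = (- \<alpha>) \<cdot>\<^sub>v z - (M *\<^sub>v (D *\<^sub>v y) - (1/2) \<cdot>\<^sub>v (B *\<^sub>v y))"
    using Mx(1,3) c unfolding w_eq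
    by (simp add: mult_minus_distrib_mat_vec[of _ n n] mult_mat_vec[of _ n n] cancel)
  also have "scalar_prod (ones n) \<dots> = - \<alpha> * scalar_prod (ones n) z
      - (scalar_prod (ones n) (M *\<^sub>v (D *\<^sub>v y)) - 1/2 * scalar_prod (ones n) (B *\<^sub>v y))"
    using Mx(1) c by (simp add: scalar_prod_minus_distrib[of _ n] scalar_prod_smult_distrib[of _ n])
  also have "scalar_prod (ones n) z = 0"
    using scalar_prod_ones_B_tilde_transpose c(1) unfolding z_def B n_def .
  also have "scalar_prod (ones n) (M *\<^sub>v (D *\<^sub>v y)) = y $ P - y $ 0 + (y $ (2 * P + 1) - y $ (P + 1))"
    using scalar_prod_ones_MD[OF GL dx P] y unfolding M D n_def .
  also have "scalar_prod (ones n) (B *\<^sub>v y) = 2 * y $ P - 2 * y $ (P + 1)"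
    using scalar_prod_ones_B_tilde y unfolding B n_def .
  \<comment> \<open>Half of the jump term removes the interface values of \<open>y\<close>; the
    remaining outer difference is zero by \<open>outer\<close>.\<close>
  finally show ?thesis using outer by (simp add: n_def)
qed

theorem theorem7:
  fixes g H U dx \<alpha>h \<alpha>u :: real
    and P :: nat
    and \<xi> \<omega> :: "nat \<Rightarrow> real"
    and h h' u u' f q :: "real \<Rightarrow> real vec"
    and D M B K Dt :: "real mat"
    and \<tau>11 \<tau>12 \<tau>21 \<tau>22 \<gamma>21 \<gamma>22 \<gamma>23 :: real
    and \<sigma>21 \<sigma>22 \<sigma>23 \<sigma>24 \<sigma>25 \<sigma>26 \<sigma>27 :: real
  assumes g: "g > 0" and H: "H > 0" and P: "P \<ge> 1" and dx: "dx > 0"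
    and \<alpha>h: "\<alpha>h \<ge> 0" and \<alpha>u: "\<alpha>u \<ge> 0"
    and GL: "gauss_lobatto P \<xi> \<omega>"
    and D: "D = block_diag2 (D_x P \<xi> \<omega> dx)"
    and M: "M = block_diag2 (M_x P \<omega> dx)"
    and B: "B = B_tilde P"
    and K: "K = minv M * B"
    and Dt: "Dt = D - (1/2) \<cdot>\<^sub>m (minv M * B)"
    and \<tau>: "\<tau>11 = 1/2" "\<tau>12 = 1/2" "\<tau>21 = 1/2" "\<tau>22 = 1/2"
    and \<gamma>: "\<gamma>21 = -1/6" "\<gamma>22 = -1/6" "\<gamma>23 = 1/12"
    and \<sigma>: "\<sigma>21 = -1/6" "\<sigma>22 = -1/6" "\<sigma>23 = 1/12" "\<sigma>24 = -1/6"
           "\<sigma>25 = 1/12" "\<sigma>26 = 1/12" "\<sigma>27 = -1/24"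
    and h_C1: "C1_curve (2 * P + 2) h h'"
    and u_C1: "C1_curve (2 * P + 2) u u'"
    and h_eq: "\<forall>t\<ge>0.
        h' t + D *\<^sub>v (H \<cdot>\<^sub>v u t + U \<cdot>\<^sub>v h t)
        = (\<tau>11 * H) \<cdot>\<^sub>v (K *\<^sub>v u t) + (\<tau>12 * U) \<cdot>\<^sub>v (K *\<^sub>v h t)
          - \<alpha>h \<cdot>\<^sub>v ((minv M * transpose_mat B * B) *\<^sub>v h t)"
    and u_eq: "\<forall>t\<ge>0.
        u' t + D *\<^sub>v (g \<cdot>\<^sub>v h t + U \<cdot>\<^sub>v u t
                   - (H\<^sup>2 * U / 3) \<cdot>\<^sub>v ((D ^\<^sub>m 2) *\<^sub>v u t)
                   - (H\<^sup>2 / 3) \<cdot>\<^sub>v (D *\<^sub>v u' t))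
        = (\<tau>21 * g) \<cdot>\<^sub>v (K *\<^sub>v h t) + (\<tau>22 * U) \<cdot>\<^sub>v (K *\<^sub>v u t)
          + H\<^sup>2 \<cdot>\<^sub>v ((\<gamma>21 \<cdot>\<^sub>m (D * K) + \<gamma>22 \<cdot>\<^sub>m (K * D) + \<gamma>23 \<cdot>\<^sub>m (K ^\<^sub>m 2)) *\<^sub>v u' t)
          + (H\<^sup>2 * U) \<cdot>\<^sub>v ((\<sigma>21 \<cdot>\<^sub>m (D ^\<^sub>m 2 * K) + \<sigma>22 \<cdot>\<^sub>m (D * K * D)
                        + \<sigma>23 \<cdot>\<^sub>m (D * K ^\<^sub>m 2) + \<sigma>24 \<cdot>\<^sub>m (K * D ^\<^sub>m 2)
                        + \<sigma>25 \<cdot>\<^sub>m (K * D * K) + \<sigma>26 \<cdot>\<^sub>m (K ^\<^sub>m 2 * D)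
                        + \<sigma>27 \<cdot>\<^sub>m (K ^\<^sub>m 3)) *\<^sub>v u t)
          - \<alpha>u \<cdot>\<^sub>v ((minv M * transpose_mat B * B) *\<^sub>v u t)"
    and f: "\<forall>t\<ge>0. f t = H \<cdot>\<^sub>v u t + U \<cdot>\<^sub>v h t"
    and q: "\<forall>t\<ge>0. q t = g \<cdot>\<^sub>v h t + U \<cdot>\<^sub>v u t
              - (H\<^sup>2 * U / 3) \<cdot>\<^sub>v ((Dt ^\<^sub>m 2) *\<^sub>v u t)
              - (H\<^sup>2 / 3) \<cdot>\<^sub>v (Dt *\<^sub>v u' t)"
    and outer_f: "\<forall>t\<ge>0. f t $ (2 * P + 1) - f t $ 0 = 0"
    and outer_q: "\<forall>t\<ge>0. q t $ (2 * P + 1) - q t $ 0 = 0"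
  shows "\<forall>t\<ge>0. g * inner_M M (ones (2 * P + 2)) (h' t) = 0 \<and>
                H * inner_M M (ones (2 * P + 2)) (u' t) = 0"
proof (intro allI impI)
  \<comment> \<open>At a fixed time the two equations are algebraic relations between four vectors,
    and the claim follows from these alone.\<close>
  fix t :: real assume t: "t \<ge> 0"
  let ?n = "2 * P + 2"
  have v: "h t \<in> carrier_vec ?n" "u t \<in> carrier_vec ?n" "h' t \<in> carrier_vec ?n" "u' t \<in> carrier_vec ?n"
    using h_C1 u_C1 t unfolding C1_curve_def by blast+
  note Mx = block_diag2_M_x[OF GL dx, folded M]
  have Bc: "B \<in> carrier_mat ?n ?n" by (simp only: B B_tilde_carrier)
  have "?n = (P + 1) + (P + 1)" by simp
  then have Dc: "D \<in> carrier_mat ?n ?n"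
    unfolding D using block_diag2_carrier[OF M_x_mult_D_x(2)[OF GL dx]] by metis
  have Kc: "K \<in> carrier_mat ?n ?n" unfolding K by (rule mult_carrier_mat[OF Mx(3) Bc])
  have Dtc: "Dt \<in> carrier_mat ?n ?n" 
    unfolding Dt K[symmetric] by (intro minus_carrier_mat smult_carrier_mat Kc)
  have d: "\<alpha> \<cdot>\<^sub>v ((minv M * transpose_mat B * B) *\<^sub>v x) \<in> carrier_vec ?n"
    if "x \<in> carrier_vec ?n" for \<alpha> x
    by (intro smult_carrier_vec[THEN iffD2] mult_mat_vec_carrier[of _ _ ?n] mult_carrier_mat[of _ _ ?n]
        Mx(3) Bc transpose_carrier_mat[THEN iffD2] that)
  have ft: "f t = H \<cdot>\<^sub>v u t + U \<cdot>\<^sub>v h t" using f t by blast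
  have fc: "f t \<in> carrier_vec ?n"
    unfolding ft by (intro add_carrier_vec smult_carrier_vec[THEN iffD2] v)
  have qt: "q t = g \<cdot>\<^sub>v h t + U \<cdot>\<^sub>v u t
              - (H\<^sup>2 * U / 3) \<cdot>\<^sub>v ((Dt ^\<^sub>m 2) *\<^sub>v u t)
              - (H\<^sup>2 / 3) \<cdot>\<^sub>v (Dt *\<^sub>v u' t)"
    using q t by blast
  have qc: "q t \<in> carrier_vec ?n"
    unfolding qt
    by (intro add_carrier_vec minus_carrier_vec smult_carrier_vec[THEN iffD2] v
        mult_mat_vec_carrier[of _ _ ?n] pow_carrier_mat Dtc)
  have "h' t = - (\<alpha>h \<cdot>\<^sub>v ((minv M * transpose_mat B * B) *\<^sub>v h t)) - Dt *\<^sub>v f t"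
    unfolding ft using h_eq[rule_format, OF t] unfolding \<tau>
    by (rule mass_equation_factored[OF Dc Kc v(1-3) d[OF v(1)] Dt[folded K]])
  then have "inner_M M (ones ?n) (h' t) = 0"
    by (rule interface_flux_conservative[OF GL dx P D M B Dt v(1) fc])
      (use outer_f t in blast)
  \<comment> \<open>The scheme has \<open>D\<close> inside its flux whereas \<open>q\<close> has
    \<open>Dt\<close>; the penalties with \<gamma> and \<sigma> make up for this difference and for
    the outer derivative.\<close>
  moreover have "u' t = - (\<alpha>u \<cdot>\<^sub>v ((minv M * transpose_mat B * B) *\<^sub>v u t)) - Dt *\<^sub>v q t"
    unfolding qt using u_eq[rule_format, OF t] unfolding \<tau> \<gamma> \<sigma>
    by (rule momentum_equation_factored[OF Dc Kc v(1,2,4) d[OF v(2)] Dt[folded K]])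
  then have "inner_M M (ones ?n) (u' t) = 0"
    by (rule interface_flux_conservative[OF GL dx P D M B Dt v(2) qc])
      (use outer_q t in blast)
  ultimately show "g * inner_M M (ones ?n) (h' t) = 0 \<and> H * inner_M M (ones ?n) (u' t) = 0"
    by simp
qed

end
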